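(* Suppose the Pearson equations $\sigma(x)\tilde w_1'(x)=q_1(x)\tilde w_1(x)$ and $\sigma(x)\tilde w_2'(x)=q_2(x)\tilde w_2(x)$ hold on $\Delta$, where $\sigma,q_1,q_2$ are polynomials and $\sigma\tilde w_1=\sigma\tilde w_2=0$ at the boundary $\partial\Delta$. Let $\Psi:=\sigma(T)\Phi$ be the Laguerre–Freud matrix. Then: (i) The type I multiple orthogonal polynomials satisfy $$\sigma(x)A_1'(x)+q_1(x)A_1(x)+\Psi^\top A_1(x)=\mathbf 0,\qquad \sigma(x)A_2'(x)+q_2(x)A_2(x)+\Psi^\top A_2(x)=\mathbf 0 .$$ (ii) The linear form $\tilde Q(x)=A_1(x)\tilde w_1(x)+A_2(x)\tilde w_2(x)$ satisfies $$\sigma(x)\tilde Q'(x)+\Psi^\top\tilde Q(x)=\mathbf 0 .$$ (iii) The type II multiple orthogonal polynomials satisfy $$(\sigma(x)B(x))'=\Psi B(x).$$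
   Context: Let $\Delta\subset\mathbb R$ be an interval, $\mathrm d\mu=v(x)\,\mathrm dx$ on $\Delta$, $w_1,w_2$ weights, and $\tilde w_a=w_av$, $a\in\{1,2\}$, with all moments finite. (At an infinite endpoint of $\Delta$, the boundary condition means that $x^k\sigma\tilde w_a\to0$ for all $k$.) All vectors and matrices are semi-infinite, indexed by $0,1,2,\dots$. Put $X(x)=(1,x,x^2,\dots)^\top$, $X_1(x)=(1,0,x,0,x^2,0,\dots)^\top$, $X_2(x)=(0,1,0,x,0,x^2,\dots)^\top$. The moment matrix $g=\int_\Delta X(x)\big(X_1(x)\tilde w_1(x)+X_2(x)\tilde w_2(x)\big)^\top\mathrm dx$ is assumed to have a Gauss–Borel factorization $g=S^{-1}H\tilde S^{-\top}$ with $S,\tilde S$ lower unitriangular and $H=\operatorname{diag}(H_0,H_1,\dots)$, all $H_n\neq0$. Set $B=SX$ (type II polynomials) and $A_a=H^{-1}\tilde SX_a$, $a\in\{1,2\}$ (type I polynomials). $\Lambda$ is the shift matrix with ones on the first superdiagonal and zeros elsewhere; $\mathscr D=\Lambda^\top\operatorname{diag}(1,2,3,\dots)$, so $X'=\mathscr DX$. $T=S\Lambda S^{-1}$ and $\Phi=S\mathscr DS^{-1}$. Derivatives of vectors are entrywise in $x$. *)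

theory Defs
  imports "HOL-Analysis.Analysis" "HOL-Library.Groups_Big_Fun"
begin

type_synonym svec = "nat \<Rightarrow> real"
type_synonym smat = "nat \<Rightarrow> nat \<Rightarrow> real"

text \<open>
  Semi-infinite vectors and matrices. An entry of a product is the sum of its nonzero terms;
  \<^const>\<open>Sum_any\<close> is 0 if there are infinitely many of them, so a product is meaningful only
  where these sums are finite.
\<close>

definition smat_mult :: "smat \<Rightarrow> smat \<Rightarrow> smat" (infixl "\<odot>" 70) where
  "(M \<odot> N) i j = Sum_any (\<lambda>k. M i k * N k j)"

definition smat_vec :: "smat \<Rightarrow> svec \<Rightarrow> svec" (infixr "\<odot>\<^sub>v" 69) where
  "(M \<odot>\<^sub>v u) i = Sum_any (\<lambda>k. M i k * u k)"

definition sdiag :: "svec \<Rightarrow> smat" where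
  "sdiag d i j = (if i = j then d i else 0)"

definition sone :: smat where
  "sone = sdiag (\<lambda>_. 1)"

definition stransp :: "smat \<Rightarrow> smat" where
  "stransp M i j = M j i"

definition lower_unitriangular :: "smat \<Rightarrow> bool" where
  "lower_unitriangular M \<longleftrightarrow> (\<forall>i. M i i = 1) \<and> (\<forall>i j. i < j \<longrightarrow> M i j = 0)"

text \<open>
  The inverse is taken within the group of lower unitriangular matrices, where all products are
  finite sums; among arbitrary semi-infinite matrices one-sided inverses need not be unique.
\<close>

definition lu_inv :: "smat \<Rightarrow> smat" where
  "lu_inv M = (THE R. lower_unitriangular R \<and> M \<odot> R = sone \<and> R \<odot> M = sone)"

primrec smat_pow :: "smat \<Rightarrow> nat \<Rightarrow> smat" where
  "smat_pow M 0 = sone"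
| "smat_pow M (Suc k) = M \<odot> smat_pow M k"

definition smat_poly :: "real poly \<Rightarrow> smat \<Rightarrow> smat" where
  "smat_poly p M i j = (\<Sum>k\<le>degree p. coeff p k * smat_pow M k i j)"

definition shift :: smat where
  "shift i j = (if j = Suc i then 1 else 0)"

definition deriv_mat :: smat where
  "deriv_mat = stransp shift \<odot> sdiag (\<lambda>n. real (Suc n))"

definition monX :: "real \<Rightarrow> svec" where
  "monX x n = x ^ n"

definition monX1 :: "real \<Rightarrow> svec" where
  "monX1 x n = (if even n then x ^ (n div 2) else 0)"

definition monX2 :: "real \<Rightarrow> svec" where
  "monX2 x n = (if odd n then x ^ (n div 2) else 0)"

definition finite_moments :: "real set \<Rightarrow> (real \<Rightarrow> real) \<Rightarrow> bool" where
  "finite_moments \<Delta> f \<longleftrightarrow> (\<forall>k::nat. set_integrable lborel \<Delta> (\<lambda>x. x ^ k * f x))"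

definition moment_matrix :: "real set \<Rightarrow> (real \<Rightarrow> real) \<Rightarrow> (real \<Rightarrow> real) \<Rightarrow> smat" where
  "moment_matrix \<Delta> f1 f2 i j =
     (LBINT x:\<Delta>. monX x i * (monX1 x j * f1 x + monX2 x j * f2 x))"

definition gauss_borel :: "smat \<Rightarrow> smat \<Rightarrow> svec \<Rightarrow> smat \<Rightarrow> bool" where
  "gauss_borel g S h St \<longleftrightarrow>
     lower_unitriangular S \<and> lower_unitriangular St \<and> (\<forall>n. h n \<noteq> 0) \<and>
     g = lu_inv S \<odot> sdiag h \<odot> stransp (lu_inv St)"

definition typeII :: "smat \<Rightarrow> real \<Rightarrow> svec" where
  "typeII S x = S \<odot>\<^sub>v monX x"

definition typeI :: "smat \<Rightarrow> svec \<Rightarrow> (real \<Rightarrow> svec) \<Rightarrow> real \<Rightarrow> svec" where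
  "typeI St h Y x = (sdiag (\<lambda>n. inverse (h n)) \<odot> St) \<odot>\<^sub>v Y x"

definition jacobi_mat :: "smat \<Rightarrow> smat" where
  "jacobi_mat S = S \<odot> shift \<odot> lu_inv S"

definition phi_mat :: "smat \<Rightarrow> smat" where
  "phi_mat S = S \<odot> deriv_mat \<odot> lu_inv S"

definition laguerre_freud :: "real poly \<Rightarrow> smat \<Rightarrow> smat" where
  "laguerre_freud \<sigma> S = smat_poly \<sigma> (jacobi_mat S) \<odot> phi_mat S"

text \<open>
  The derivative is one-sided at an endpoint belonging to \<open>\<Delta>\<close>. A weight that is singular at a
  finite endpoint is covered by taking \<open>\<Delta>\<close> open there.
\<close>

definition pearson :: "real set \<Rightarrow> real poly \<Rightarrow> real poly \<Rightarrow> (real \<Rightarrow> real) \<Rightarrow> bool" where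
  "pearson \<Delta> \<sigma> q f \<longleftrightarrow>
     (\<forall>x\<in>\<Delta>. \<exists>D. (f has_real_derivative D) (at x within \<Delta>) \<and> poly \<sigma> x * D = poly q x * f x)"

text \<open>
  The boundary values are limits from within \<open>\<Delta>\<close>, since the weights need not be defined (or
  bounded) at an endpoint not belonging to \<open>\<Delta>\<close>.
\<close>

definition vanishes_at_boundary :: "real set \<Rightarrow> real poly \<Rightarrow> (real \<Rightarrow> real) \<Rightarrow> bool" where
  "vanishes_at_boundary \<Delta> \<sigma> f \<longleftrightarrow>
     (\<forall>c\<in>frontier \<Delta>. ((\<lambda>x. poly \<sigma> x * f x) \<longlongrightarrow> 0) (at c within \<Delta>)) \<and>
     (\<not> bdd_above \<Delta> \<longrightarrow> (\<forall>k::nat. ((\<lambda>x. x ^ k * (poly \<sigma> x * f x)) \<longlongrightarrow> 0) at_top)) \<and>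
     (\<not> bdd_below \<Delta> \<longrightarrow> (\<forall>k::nat. ((\<lambda>x. x ^ k * (poly \<sigma> x * f x)) \<longlongrightarrow> 0) at_bot))"

end

theory Submission
  imports Defs
begin

text \<open>
  From \<open>T B = x B\<close> and \<open>B' = \<Phi> B\<close> one gets \<open>\<sigma>(T) B = \<sigma> B\<close>, and differentiating gives
  \<open>(\<sigma> B)' = \<Psi> B\<close>. For the type I equations, every pair of polynomials, in particular
  the \<open>n\<close>-th entries of \<open>\<sigma> A\<^sub>a' + q\<^sub>a A\<^sub>a\<close> (\<open>a = 1, 2\<close>), is a finite combination \<open>\<Sum>k. e k A\<^sub>a k\<close>
  with the same coefficients for both \<open>a\<close>. By biorthogonality \<open>e i\<close> is the integral of
  \<open>B i\<close> against \<open>\<Sum>\<^sub>a (\<sigma> A\<^sub>a' + q\<^sub>a A\<^sub>a) w\<^sub>a\<close>, the \<open>n\<close>-th entry of \<open>\<sigma> Q'\<close>. Integration by parts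
  moves the derivative to \<open>(\<sigma> B i)' = (\<Psi> B) i\<close>, and biorthogonality again gives \<open>e i = - \<Psi> i n\<close>.
  In particular the columns of \<open>\<Psi>\<close> are finite.
\<close>

subsection \<open>Row-finite matrices\<close>

text \<open>A row-finite left factor makes every entry of a product a genuine finite sum, so the
  default value of \<open>Sum_any\<close> cannot interfere.\<close>

definition row_finite :: "smat \<Rightarrow> bool" where
  "row_finite M \<longleftrightarrow> (\<forall>i. finite {j. M i j \<noteq> 0})"

lemma smat_mult_expand:
  assumes "finite F" "{k. M i k \<noteq> 0} \<subseteq> F"
  shows "(M \<odot> N) i j = (\<Sum>k\<in>F. M i k * N k j)"
  unfolding smat_mult_def using assms by (intro Sum_any.expand_superset) auto

lemma smat_vec_expand:
  assumes "finite F" "{k. M i k \<noteq> 0} \<subseteq> F"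
  shows "(M \<odot>\<^sub>v u) i = (\<Sum>k\<in>F. M i k * u k)"
  unfolding smat_vec_def using assms by (intro Sum_any.expand_superset) auto

text \<open>A vector is read as the matrix all of whose columns equal it, so that facts about matrix
  products carry over.\<close>

lemma smat_vec_eq_mult: "(M \<odot>\<^sub>v u) i = (M \<odot> (\<lambda>k _. u k)) i 0"
  by (simp add: smat_vec_def smat_mult_def)

lemma smat_mult_support:
  assumes "finite F" "{k. M i k \<noteq> 0} \<subseteq> F"
  shows "{j. (M \<odot> N) i j \<noteq> 0} \<subseteq> (\<Union>k\<in>F. {j. N k j \<noteq> 0})"
proof
  fix j assume "j \<in> {j. (M \<odot> N) i j \<noteq> 0}"
  then have "(\<Sum>k\<in>F. M i k * N k j) \<noteq> 0"
    by (simp add: smat_mult_expand[of F M i, OF assms])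
  then obtain k where "k \<in> F" "M i k * N k j \<noteq> 0"
    by (rule sum.not_neutral_contains_not_neutral)
  then show "j \<in> (\<Union>k\<in>F. {j. N k j \<noteq> 0})" by auto
qed

lemma row_finite_mult:
  assumes "row_finite M" "row_finite N"
  shows "row_finite (M \<odot> N)"
  unfolding row_finite_def
proof
  fix i
  have "finite {k. M i k \<noteq> 0}" using assms by (simp add: row_finite_def)
  then show "finite {j. (M \<odot> N) i j \<noteq> 0}"
    using assms(2)
    by (intro finite_subset[OF smat_mult_support[OF _ subset_refl]])
      (auto simp: row_finite_def)
qed

text \<open>The double sum runs over the finite sets \<open>F\<close> and \<open>G\<close>, which
  come from \<open>M\<close> and \<open>N\<close> alone, so it can be interchanged for arbitrary
  \<open>P\<close>. In particular an upper triangular matrix may stand on the right.\<close>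

lemma smat_mult_assoc:
  assumes "row_finite M" "row_finite N"
  shows "(M \<odot> N) \<odot> P = M \<odot> (N \<odot> P)"
proof (intro ext)
  fix i j
  define F where "F = {k. M i k \<noteq> 0}"
  define G where "G = (\<Union>k\<in>F. {j. N k j \<noteq> 0})"
  have F: "finite F" "{k. M i k \<noteq> 0} \<subseteq> F"
    using assms by (auto simp: F_def row_finite_def)
  have G: "finite G" using F assms by (auto simp: G_def row_finite_def)
  have "((M \<odot> N) \<odot> P) i j = (\<Sum>k\<in>G. (M \<odot> N) i k * P k j)"
    using G smat_mult_support[of F M, OF F] by (intro smat_mult_expand) (auto simp: G_def)
  also have "\<dots> = (\<Sum>k\<in>G. \<Sum>l\<in>F. M i l * (N l k * P k j))"
    by (simp add: smat_mult_expand[of F M, OF F] sum_distrib_right mult.assoc)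
  also have "\<dots> = (\<Sum>l\<in>F. M i l * (\<Sum>k\<in>G. N l k * P k j))"
    by (subst sum.swap) (simp add: sum_distrib_left)
  also have "\<dots> = (\<Sum>l\<in>F. M i l * (N \<odot> P) l j)"
    by (intro sum.cong refl arg_cong2[where f = "(*)"] smat_mult_expand[symmetric] G)
      (auto simp: G_def)
  also have "\<dots> = (M \<odot> (N \<odot> P)) i j" by (rule smat_mult_expand[of F M, OF F, symmetric])
  finally show "((M \<odot> N) \<odot> P) i j = (M \<odot> (N \<odot> P)) i j" .
qed

lemma smat_vec_assoc:
  assumes "row_finite M" "row_finite N"
  shows "(M \<odot> N) \<odot>\<^sub>v u = M \<odot>\<^sub>v (N \<odot>\<^sub>v u)"
  using smat_mult_assoc[OF assms, of "\<lambda>k _. u k"]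
  by (intro ext) (simp add: smat_vec_def smat_mult_def fun_eq_iff)

lemma row_finite_sdiag: "row_finite (sdiag d)"
  unfolding row_finite_def
proof
  show "finite {j. sdiag d i j \<noteq> 0}" for i
    by (rule finite_subset[of _ "{i}"]) (auto simp: sdiag_def)
qed

lemma row_finite_sone: "row_finite sone"
  by (simp add: sone_def row_finite_sdiag)

lemma row_finite_shift: "row_finite shift"
  by (simp add: row_finite_def shift_def)

lemma lower_unitriangular_support: "lower_unitriangular M \<Longrightarrow> {j. M i j \<noteq> 0} \<subseteq> {..i}"
  unfolding lower_unitriangular_def using leI by blast

lemma row_finite_lower_unitriangular: "lower_unitriangular M \<Longrightarrow> row_finite M"
  unfolding row_finite_def using lower_unitriangular_support finite_subset by blast

lemma row_finite_deriv_mat: "row_finite deriv_mat"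
proof -
  have "finite {j. stransp shift i j \<noteq> 0}" for i
    by (rule finite_subset[of _ "{..i}"]) (auto simp: stransp_def shift_def)
  then have "row_finite (stransp shift)" by (simp add: row_finite_def)
  then show ?thesis unfolding deriv_mat_def by (intro row_finite_mult row_finite_sdiag)
qed

lemma row_finite_smat_pow: "row_finite M \<Longrightarrow> row_finite (smat_pow M k)"
  by (induction k) (simp_all add: row_finite_sone row_finite_mult)

lemma row_finite_smat_poly:
  assumes "row_finite M"
  shows "row_finite (smat_poly p M)"
  unfolding row_finite_def
proof
  fix i
  have "{j. smat_poly p M i j \<noteq> 0} \<subseteq> (\<Union>k\<le>degree p. {j. smat_pow M k i j \<noteq> 0})"
  proof
    fix j assume "j \<in> {j. smat_poly p M i j \<noteq> 0}"
    then have "(\<Sum>k\<le>degree p. coeff p k * smat_pow M k i j) \<noteq> 0"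
      by (simp add: smat_poly_def)
    then obtain k where "k \<in> {..degree p}" "coeff p k * smat_pow M k i j \<noteq> 0"
      by (rule sum.not_neutral_contains_not_neutral)
    then show "j \<in> (\<Union>k\<le>degree p. {j. smat_pow M k i j \<noteq> 0})" by auto
  qed
  then show "finite {j. smat_poly p M i j \<noteq> 0}"
    using row_finite_smat_pow[OF assms] by (auto simp: row_finite_def intro: finite_subset)
qed

lemma sdiag_mult: "(sdiag d \<odot> M) i j = d i * M i j"
  by (subst smat_mult_expand[of "{i}"]) (auto simp: sdiag_def)

text \<open>The sum collapses through the column of the diagonal matrix and not through the row of
  \<open>M\<close>, hence the direct recourse to \<open>Sum_any\<close>.\<close>

lemma mult_sdiag: "(M \<odot> sdiag d) i j = M i j * d j"
proof -
  have "(M \<odot> sdiag d) i j = (\<Sum>k\<in>{j}. M i k * sdiag d k j)"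
    unfolding smat_mult_def by (rule Sum_any.expand_superset) (auto simp: sdiag_def)
  then show ?thesis by (simp add: sdiag_def)
qed

lemma sone_mult [simp]: "sone \<odot> M = M"
  by (intro ext) (simp add: sone_def sdiag_mult)

lemma mult_sone [simp]: "M \<odot> sone = M"
  by (intro ext) (simp add: sone_def mult_sdiag)

lemma sone_vec [simp]: "sone \<odot>\<^sub>v u = u"
  by (intro ext) (simp add: smat_vec_eq_mult)

text \<open>For nonzero \<open>c\<close> scaling preserves the support of the summands, so both
  sides are finite sums or both take the default value 0.\<close>

lemma smat_vec_scale: "M \<odot>\<^sub>v (\<lambda>k. c * u k) = (\<lambda>i. c * (M \<odot>\<^sub>v u) i)"
proof (cases "c = 0")
  case False
  then have "{k. M i k * (c * u k) \<noteq> 0} = {k. M i k * u k \<noteq> 0}" for i by auto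
  then show ?thesis
    by (intro ext)
      (simp add: smat_vec_def Sum_any.expand_set sum_distrib_left mult.left_commute)
qed (simp add: smat_vec_def fun_eq_iff)

section \<open>Inversion of lower unitriangular matrices\<close>

lemma lower_unitriangular_mult_expand:
  assumes "lower_unitriangular M"
  shows "(M \<odot> N) i j = (\<Sum>k\<le>i. M i k * N k j)"
  by (intro smat_mult_expand lower_unitriangular_support assms finite_atMost)

lemma lower_unitriangular_vec_expand:
  assumes "lower_unitriangular M"
  shows "(M \<odot>\<^sub>v u) i = (\<Sum>k\<le>i. M i k * u k)"
  by (intro smat_vec_expand lower_unitriangular_support assms finite_atMost)

text \<open>Row \<open>i\<close> of the equation \<open>M \<odot> R = sone\<close> determines
  \<open>R i j\<close> from the earlier rows, because \<open>M i i = 1\<close>.\<close>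

fun forward_subst :: "smat \<Rightarrow> smat" where
  "forward_subst M i j =
    (if i < j then 0 else if i = j then 1 else - (\<Sum>k\<in>{..<i}. M i k * forward_subst M k j))"

declare forward_subst.simps [simp del]

lemma lower_unitriangular_forward_subst: "lower_unitriangular (forward_subst M)"
  unfolding lower_unitriangular_def
  by (intro conjI allI impI; subst forward_subst.simps) simp_all

lemma mult_forward_subst:
  assumes "lower_unitriangular M"
  shows "M \<odot> forward_subst M = sone"
proof (intro ext)
  fix i j
  have "(M \<odot> forward_subst M) i j
      = (\<Sum>k<i. M i k * forward_subst M k j) + M i i * forward_subst M i j"
    using assms by (simp add: lower_unitriangular_mult_expand flip: lessThan_Suc_atMost)
  also have "\<dots> = sone i j"
  proof (cases "i \<le> j")
    case True
    then have "(\<Sum>k<i. M i k * forward_subst M k j) = 0"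
      using lower_unitriangular_forward_subst[of M]
      by (intro sum.neutral) (auto simp: lower_unitriangular_def)
    with True assms lower_unitriangular_forward_subst[of M] show ?thesis
      by (auto simp: lower_unitriangular_def sone_def sdiag_def)
  next
    case False
    then show ?thesis
      using assms
      by (subst (2) forward_subst.simps) (simp add: lower_unitriangular_def sone_def sdiag_def)
  qed
  finally show "(M \<odot> forward_subst M) i j = sone i j" .
qed

text \<open>Forward substitution yields a right inverse \<open>R\<close> of \<open>M\<close> and a
  right inverse \<open>R'\<close> of \<open>R\<close>. Associativity forces \<open>M = R'\<close>,
  so \<open>R\<close> is two-sided; any other inverse \<open>Q\<close> equals
  \<open>Q \<odot> (M \<odot> R) = R\<close>, which justifies the definite description.\<close>

lemma lu_inv:
  assumes M: "lower_unitriangular M"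
  shows lower_unitriangular_lu_inv: "lower_unitriangular (lu_inv M)"
    and mult_lu_inv: "M \<odot> lu_inv M = sone"
    and lu_inv_mult: "lu_inv M \<odot> M = sone"
proof -
  define R where "R = forward_subst M"
  define R' where "R' = forward_subst R"
  note rf = row_finite_lower_unitriangular
  have R: "lower_unitriangular R" "M \<odot> R = sone"
    using M by (simp_all add: R_def lower_unitriangular_forward_subst mult_forward_subst)
  have R': "lower_unitriangular R'" "R \<odot> R' = sone"
    using R by (simp_all add: R'_def lower_unitriangular_forward_subst mult_forward_subst)
  have "M = M \<odot> (R \<odot> R')" by (simp add: R')
  also have "\<dots> = R'" using smat_mult_assoc[OF rf[OF M] rf[OF R(1)], of R'] R by simp
  finally have RM: "R \<odot> M = sone" using R' by simp
  have "lu_inv M = R"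
    unfolding lu_inv_def
  proof (rule the_equality)
    fix Q assume Q: "lower_unitriangular Q \<and> M \<odot> Q = sone \<and> Q \<odot> M = sone"
    have "Q = Q \<odot> (M \<odot> R)" by (simp add: R)
    also have "\<dots> = R" using smat_mult_assoc[of Q M R] Q rf M by simp
    finally show "Q = R" .
  qed (use R RM in simp)
  then show "lower_unitriangular (lu_inv M)" "M \<odot> lu_inv M = sone" "lu_inv M \<odot> M = sone"
    using R RM by simp_all
qed

subsection \<open>Type II polynomials\<close>

lemma shift_monX: "shift \<odot>\<^sub>v monX x = (\<lambda>n. x * monX x n)"
proof
  fix i show "(shift \<odot>\<^sub>v monX x) i = x * monX x i"
    by (subst smat_vec_expand[of "{Suc i}"]) (auto simp: shift_def monX_def)
qed

lemma deriv_mat_entry: "deriv_mat i j = (if i = Suc j then real i else 0)"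
  by (simp add: deriv_mat_def mult_sdiag stransp_def shift_def)

lemma monX_has_deriv: "((\<lambda>t. monX t n) has_real_derivative (deriv_mat \<odot>\<^sub>v monX x) n) (at x)"
proof -
  have "(deriv_mat \<odot>\<^sub>v monX x) n = real n * x ^ (n - 1)"
    by (subst smat_vec_expand[of "{n - 1}"]) (auto simp: deriv_mat_entry monX_def)
  then show ?thesis by (auto simp: monX_def intro!: derivative_eq_intros)
qed

lemma smat_vec_has_deriv:
  assumes "row_finite M"
    and "\<And>k. ((\<lambda>t. u t k) has_real_derivative u' k) (at x)"
  shows "((\<lambda>t. (M \<odot>\<^sub>v u t) i) has_real_derivative (M \<odot>\<^sub>v u') i) (at x)"
proof -
  have F: "finite {k. M i k \<noteq> 0}" using assms by (simp add: row_finite_def)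
  show ?thesis
    unfolding smat_vec_expand[of _ M i, OF F subset_refl] by (intro DERIV_sum DERIV_cmult assms)
qed

context
  fixes S :: smat
  assumes S: "lower_unitriangular S"
begin

lemma row_finite_unitriangular: "row_finite S" "row_finite (lu_inv S)"
  using S lower_unitriangular_lu_inv row_finite_lower_unitriangular by blast+

lemma row_finite_jacobi_mat: "row_finite (jacobi_mat S)"
  unfolding jacobi_mat_def by (intro row_finite_mult row_finite_unitriangular row_finite_shift)

lemma row_finite_phi_mat: "row_finite (phi_mat S)"
  unfolding phi_mat_def by (intro row_finite_mult row_finite_unitriangular row_finite_deriv_mat)

lemma row_finite_laguerre_freud: "row_finite (laguerre_freud \<sigma> S)"
  unfolding laguerre_freud_def
  by (intro row_finite_mult row_finite_smat_poly row_finite_jacobi_mat row_finite_phi_mat)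

text \<open>Since B = S X, the factor \<open>lu_inv S\<close> turns B back into X, on which shift
  and differentiation act explicitly.\<close>

lemma conjugate_typeII:
  assumes "row_finite M"
  shows "(S \<odot> M \<odot> lu_inv S) \<odot>\<^sub>v typeII S x = S \<odot>\<^sub>v (M \<odot>\<^sub>v monX x)"
proof -
  have "lu_inv S \<odot>\<^sub>v typeII S x = monX x"
    unfolding typeII_def
    by (simp add: smat_vec_assoc[symmetric] row_finite_unitriangular lu_inv_mult S)
  then show ?thesis
    by (simp add: smat_vec_assoc row_finite_mult row_finite_unitriangular assms)
qed

lemma jacobi_mat_typeII: "jacobi_mat S \<odot>\<^sub>v typeII S x = (\<lambda>n. x * typeII S x n)"
  unfolding jacobi_mat_def conjugate_typeII[OF row_finite_shift]
  by (simp add: shift_monX smat_vec_scale typeII_def)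

lemma typeII_has_deriv:
  "((\<lambda>t. typeII S t n) has_real_derivative (phi_mat S \<odot>\<^sub>v typeII S x) n) (at x)"
  unfolding phi_mat_def conjugate_typeII[OF row_finite_deriv_mat] unfolding typeII_def
  by (intro smat_vec_has_deriv row_finite_unitriangular monX_has_deriv)

lemma smat_pow_jacobi_mat_typeII:
  "smat_pow (jacobi_mat S) k \<odot>\<^sub>v typeII S x = (\<lambda>n. x ^ k * typeII S x n)"
proof (induction k)
  case (Suc k)
  then show ?case
    by (simp add: smat_vec_assoc row_finite_jacobi_mat row_finite_smat_pow smat_vec_scale
        jacobi_mat_typeII mult.commute mult.left_commute)
qed simp

lemma smat_poly_jacobi_mat_typeII:
  "smat_poly p (jacobi_mat S) \<odot>\<^sub>v typeII S x = (\<lambda>n. poly p x * typeII S x n)"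
proof
  fix i
  let ?T = "\<lambda>k. smat_pow (jacobi_mat S) k" and ?B = "typeII S x"
  \<comment> \<open>Cancellation may make the row of the polynomial sparser than the rows of the
    powers. \<open>F\<close> covers all these supports, so that the sums over \<open>j\<close> and
    \<open>k\<close> can be swapped.\<close>
  define F where "F = {j. smat_poly p (jacobi_mat S) i j \<noteq> 0}
    \<union> (\<Union>k\<le>degree p. {j. ?T k i j \<noteq> 0})"
  have F: "finite F"
    using row_finite_smat_pow[OF row_finite_jacobi_mat]
      row_finite_smat_poly[OF row_finite_jacobi_mat]
    by (auto simp: F_def row_finite_def)
  have "(smat_poly p (jacobi_mat S) \<odot>\<^sub>v ?B) i = (\<Sum>j\<in>F. smat_poly p (jacobi_mat S) i j * ?B j)"
    using F by (intro smat_vec_expand) (auto simp: F_def)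
  also have "\<dots> = (\<Sum>k\<le>degree p. coeff p k * (\<Sum>j\<in>F. ?T k i j * ?B j))"
    unfolding smat_poly_def sum_distrib_left sum_distrib_right
    by (subst sum.swap) (simp add: mult.assoc)
  also have "\<dots> = (\<Sum>k\<le>degree p. coeff p k * (?T k \<odot>\<^sub>v ?B) i)"
    by (intro sum.cong refl arg_cong2[where f = "(*)"] smat_vec_expand[symmetric] F)
      (auto simp: F_def)
  also have "\<dots> = poly p x * ?B i"
    by (simp add: smat_pow_jacobi_mat_typeII poly_altdef sum_distrib_right mult.assoc)
  finally show "(smat_poly p (jacobi_mat S) \<odot>\<^sub>v ?B) i = poly p x * ?B i" .
qed

text \<open>The matrix \<open>smat_poly \<sigma> (jacobi_mat S)\<close> is constant in
  \<open>t\<close>, so differentiating its product with B only differentiates B, which contributes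
  the factor \<open>phi_mat S\<close>.\<close>

lemma laguerre_freud_typeII:
  "((\<lambda>t. poly \<sigma> t * typeII S t n) has_real_derivative
    (laguerre_freud \<sigma> S \<odot>\<^sub>v typeII S x) n) (at x)"
proof -
  have "((\<lambda>t. (smat_poly \<sigma> (jacobi_mat S) \<odot>\<^sub>v typeII S t) n) has_real_derivative
     (smat_poly \<sigma> (jacobi_mat S) \<odot>\<^sub>v (phi_mat S \<odot>\<^sub>v typeII S x)) n) (at x)"
    by (intro smat_vec_has_deriv row_finite_smat_poly row_finite_jacobi_mat typeII_has_deriv)
  then show ?thesis
    by (simp add: smat_poly_jacobi_mat_typeII laguerre_freud_def smat_vec_assoc
        row_finite_smat_poly row_finite_jacobi_mat row_finite_phi_mat)
qed

end

section \<open>Type II entries as formal polynomials\<close>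

definition typeII_poly :: "smat \<Rightarrow> nat \<Rightarrow> real poly" where
  "typeII_poly S n = (\<Sum>k\<le>n. smult (S n k) (monom 1 k))"

lemma poly_typeII_poly:
  "lower_unitriangular S \<Longrightarrow> poly (typeII_poly S n) x = typeII S x n"
  by (simp add: typeII_poly_def typeII_def lower_unitriangular_vec_expand poly_sum poly_monom monX_def)

text \<open>Integration by parts needs the type II equation as an identity of formal polynomials; it
  follows from uniqueness of the derivative at every point.\<close>

lemma pderiv_mult_typeII_poly:
  assumes "lower_unitriangular S"
  shows "pderiv (\<sigma> * typeII_poly S i) =
    (\<Sum>m | laguerre_freud \<sigma> S i m \<noteq> 0. smult (laguerre_freud \<sigma> S i m) (typeII_poly S m))"
proof (rule poly_ext)
  fix x
  let ?P = "laguerre_freud \<sigma> S"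
  have F: "finite {m. ?P i m \<noteq> 0}"
    using row_finite_laguerre_freud[OF assms] by (simp add: row_finite_def)
  have "((\<lambda>t. poly (\<sigma> * typeII_poly S i) t) has_real_derivative (?P \<odot>\<^sub>v typeII S x) i) (at x)"
    using laguerre_freud_typeII[OF assms] by (simp add: poly_typeII_poly assms)
  then have "poly (pderiv (\<sigma> * typeII_poly S i)) x = (?P \<odot>\<^sub>v typeII S x) i"
    by (rule DERIV_unique[OF poly_DERIV])
  then show "poly (pderiv (\<sigma> * typeII_poly S i)) x =
      poly (\<Sum>m | ?P i m \<noteq> 0. smult (?P i m) (typeII_poly S m)) x"
    by (simp add: smat_vec_expand[of _ ?P i, OF F subset_refl] poly_sum poly_typeII_poly assms)
qed

subsection \<open>Type I polynomials\<close>

definition monX1_poly :: "nat \<Rightarrow> real poly" where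
  "monX1_poly n = (if even n then monom 1 (n div 2) else 0)"

definition monX2_poly :: "nat \<Rightarrow> real poly" where
  "monX2_poly n = (if odd n then monom 1 (n div 2) else 0)"

lemma poly_monX1_poly: "poly (monX1_poly n) x = monX1 x n"
  by (simp add: monX1_poly_def monX1_def poly_monom)

lemma poly_monX2_poly: "poly (monX2_poly n) x = monX2 x n"
  by (simp add: monX2_poly_def monX2_def poly_monom)

text \<open>\<open>monX1_poly\<close> lives on even indices and \<open>monX2_poly\<close> on odd
  ones, so interleaving the coefficients of \<open>p\<close> and \<open>r\<close> gives a single
  sequence \<open>c\<close> from which each family picks out its own polynomial.\<close>

lemma monX_poly_expansion:
  assumes "degree p < d" "degree r < d"
  defines "c \<equiv> \<lambda>j. if even j then coeff p (j div 2) else coeff r (j div 2)"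
  shows "(\<Sum>j<2 * d. smult (c j) (monX1_poly j)) = p"
    and "(\<Sum>j<2 * d. smult (c j) (monX2_poly j)) = r"
proof -
  have split: "(\<Sum>j<2 * n. f j) = (\<Sum>k<n. f (2 * k) + f (Suc (2 * k)))" for n and f :: "nat \<Rightarrow> real poly"
    by (induction n) (simp_all add: ac_simps)
  have monoms: "(\<Sum>k<d. monom (coeff u k) k) = u" if "degree u < d" for u :: "real poly"
  proof -
    have "(\<Sum>k<d. monom (coeff u k) k) = (\<Sum>k\<le>d - 1. monom (coeff u k) k)"
      using that by (intro sum.cong) auto
    also have "\<dots> = u" using that by (intro poly_as_sum_of_monoms') simp
    finally show ?thesis .
  qed
  show "(\<Sum>j<2 * d. smult (c j) (monX1_poly j)) = p" "(\<Sum>j<2 * d. smult (c j) (monX2_poly j)) = r"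
    unfolding split by (simp_all add: c_def monX1_poly_def monX2_poly_def smult_monom monoms assms)
qed

text \<open>\<open>Y\<close> is left arbitrary so that both type I families share one
  construction.\<close>

definition typeI_poly :: "smat \<Rightarrow> svec \<Rightarrow> (nat \<Rightarrow> real poly) \<Rightarrow> nat \<Rightarrow> real poly" where
  "typeI_poly St h Y n = smult (inverse (h n)) (\<Sum>j\<le>n. smult (St n j) (Y j))"

lemma poly_typeI_poly:
  assumes "lower_unitriangular St" "\<And>j. poly (Y j) x = y x j"
  shows "poly (typeI_poly St h Y n) x = typeI St h y x n"
proof -
  have "typeI St h y x n = inverse (h n) * (St \<odot>\<^sub>v y x) n"
    unfolding typeI_def
    by (subst smat_vec_assoc)
      (simp_all add: row_finite_sdiag row_finite_lower_unitriangular assms sdiag_mult smat_vec_eq_mult)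
  then show ?thesis
    by (simp add: typeI_poly_def lower_unitriangular_vec_expand assms poly_sum)
qed

text \<open>The relation A = H^(-1) St Y is solved for Y. The coefficients do not involve
  \<open>Y\<close>, so they are the same for both families.\<close>

lemma typeI_poly_inversion:
  assumes St: "lower_unitriangular St" and h: "\<And>n. h n \<noteq> 0"
  shows "Y j = (\<Sum>k\<le>j. smult (lu_inv St j k * h k) (typeI_poly St h Y k))"
proof (rule poly_ext)
  fix x
  define y where "y n = poly (Y n) x" for n
  have A: "h k * poly (typeI_poly St h Y k) x = (St \<odot>\<^sub>v y) k" for k
    using h by (simp add: typeI_poly_def lower_unitriangular_vec_expand St poly_sum y_def)
  have "y = lu_inv St \<odot>\<^sub>v (St \<odot>\<^sub>v y)"
    by (simp add: smat_vec_assoc[symmetric] row_finite_lower_unitriangular lower_unitriangular_lu_inv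
        lu_inv_mult St)
  then have "y j = (\<Sum>k\<le>j. lu_inv St j k * (h k * poly (typeI_poly St h Y k) x))"
    unfolding A lower_unitriangular_vec_expand[OF lower_unitriangular_lu_inv[OF St], symmetric]
    by (rule fun_cong)
  then show "poly (Y j) x = poly (\<Sum>k\<le>j. smult (lu_inv St j k * h k) (typeI_poly St h Y k)) x"
    by (simp add: poly_sum y_def mult.assoc)
qed

text \<open>The interleaved monomial expansion is composed with the inversion formula. Both use
  coefficients common to the two families, so a single \<open>e\<close> expands \<open>p\<close> and
  \<open>r\<close> at once, as biorthogonality requires.\<close>

lemma typeI_poly_expansion:
  fixes p r :: "real poly"
  assumes St: "lower_unitriangular St" and h: "\<And>n. h n \<noteq> 0"
  obtains N e where
    "p = (\<Sum>k<N. smult (e k) (typeI_poly St h monX1_poly k))"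
    "r = (\<Sum>k<N. smult (e k) (typeI_poly St h monX2_poly k))"
proof -
  \<comment> \<open>A strict degree bound for both polynomials; interleaving then uses the indices
    below \<open>2 * d\<close>.\<close>
  define d where "d = Suc (max (degree p) (degree r))"
  define c where "c j = (if even j then coeff p (j div 2) else coeff r (j div 2))" for j
  define e where "e k = (\<Sum>j<2 * d. c j * (lu_inv St j k * h k))" for k
  have expand: "(\<Sum>j<2 * d. smult (c j) (Y j)) = (\<Sum>k<2 * d. smult (e k) (typeI_poly St h Y k))" for Y
  proof -
    \<comment> \<open>The expansions are padded to a common range, with coefficients that vanish by
      triangularity, so that the sums over \<open>j\<close> and \<open>k\<close> can be
      swapped.\<close>
    have "Y j = (\<Sum>k<2 * d. smult (lu_inv St j k * h k) (typeI_poly St h Y k))" if "j < 2 * d" for j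
    proof -
      have "Y j = (\<Sum>k\<le>j. smult (lu_inv St j k * h k) (typeI_poly St h Y k))"
        by (rule typeI_poly_inversion[OF St h])
      also have "\<dots> = (\<Sum>k<2 * d. smult (lu_inv St j k * h k) (typeI_poly St h Y k))"
        using that lower_unitriangular_lu_inv[OF St]
        by (intro sum.mono_neutral_left) (auto simp: lower_unitriangular_def)
      finally show ?thesis .
    qed
    then have "(\<Sum>j<2 * d. smult (c j) (Y j)) = (\<Sum>j<2 * d. smult (c j)
        (\<Sum>k<2 * d. smult (lu_inv St j k * h k) (typeI_poly St h Y k)))"
      by (intro sum.cong refl arg_cong2[where f = smult]) simp
    also have "\<dots> = (\<Sum>k<2 * d. \<Sum>j<2 * d. smult (c j * (lu_inv St j k * h k)) (typeI_poly St h Y k))"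
      by (subst sum.swap) (simp add: poly_eq_poly_eq_iff[symmetric] fun_eq_iff poly_sum
          sum_distrib_left mult.assoc)
    finally show ?thesis by (simp add: e_def smult_sum)
  qed
  have "degree p < d" "degree r < d" by (auto simp: d_def)
  from monX_poly_expansion[OF this] that[of e "2 * d"] show ?thesis
    unfolding c_def[symmetric] expand by simp
qed

subsection \<open>Biorthogonality and integration by parts\<close>

definition weighted_integral :: "real set \<Rightarrow> (real \<Rightarrow> real) \<Rightarrow> real poly \<Rightarrow> real" where
  "weighted_integral \<Delta> f p = (LBINT x:\<Delta>. poly p x * f x)"

context
  fixes \<Delta> :: "real set" and f :: "real \<Rightarrow> real"
  assumes moments: "finite_moments \<Delta> f"
begin

lemma set_integrable_poly_mult: "set_integrable lborel \<Delta> (\<lambda>x. poly p x * f x)"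
proof -
  have "set_integrable lborel \<Delta> (\<lambda>x. coeff p k * (x ^ k * f x))" for k
    using moments by (simp add: finite_moments_def)
  then have "integrable lborel
      (\<lambda>x. \<Sum>k\<le>degree p. indicator \<Delta> x *\<^sub>R (coeff p k * (x ^ k * f x)))"
    unfolding set_integrable_def by (rule Bochner_Integration.integrable_sum)
  then show ?thesis
    unfolding set_integrable_def scaleR_right.sum[symmetric]
    by (simp only: poly_altdef sum_distrib_right mult.assoc)
qed

lemma weighted_integral_add:
  "weighted_integral \<Delta> f (p + r) = weighted_integral \<Delta> f p + weighted_integral \<Delta> f r"
  unfolding weighted_integral_def
  by (simp add: distrib_right set_integral_add set_integrable_poly_mult)

lemma weighted_integral_smult:
  "weighted_integral \<Delta> f (smult c p) = c * weighted_integral \<Delta> f p"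
  unfolding weighted_integral_def by (simp add: mult.assoc)

lemma weighted_integral_sum:
  "weighted_integral \<Delta> f (\<Sum>i\<in>F. p i) = (\<Sum>i\<in>F. weighted_integral \<Delta> f (p i))"
proof (induction F rule: infinite_finite_induct)
  case (insert i F)
  then show ?case by (simp add: weighted_integral_add)
qed (simp_all add: weighted_integral_def)

end

text \<open>In matrix form the left-hand side is the entry \<open>(i, n)\<close> of S g St^T H^(-1),
  and the factorization of g reduces this product to the identity.\<close>

lemma gauss_borel_biorthogonal:
  assumes GB: "gauss_borel (moment_matrix \<Delta> f1 f2) S h St"
    and "finite_moments \<Delta> f1" "finite_moments \<Delta> f2"
  shows "weighted_integral \<Delta> f1 (typeII_poly S i * typeI_poly St h monX1_poly n) +
    weighted_integral \<Delta> f2 (typeII_poly S i * typeI_poly St h monX2_poly n) =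
    (if i = n then 1 else 0)"
proof -
  define g where "g = moment_matrix \<Delta> f1 f2"
  have S: "lower_unitriangular S" and St: "lower_unitriangular St" and h: "\<And>n. h n \<noteq> 0"
    and g_eq: "g = lu_inv S \<odot> sdiag h \<odot> stransp (lu_inv St)"
    using GB by (auto simp: gauss_borel_def g_def)
  note rf = row_finite_lower_unitriangular row_finite_mult row_finite_sdiag
    lower_unitriangular_lu_inv
  have g_entry: "g k j = weighted_integral \<Delta> f1 (monom 1 k * monX1_poly j) +
      weighted_integral \<Delta> f2 (monom 1 k * monX2_poly j)" for k j
    unfolding g_def moment_matrix_def weighted_integral_def
    by (subst set_integral_add(2)[symmetric, OF set_integrable_poly_mult set_integrable_poly_mult])
      (simp_all add: assms poly_monX1_poly poly_monX2_poly poly_monom monX_def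
        distrib_left mult.assoc)
  \<comment> \<open>\<open>S \<odot> g\<close> is H times the transpose of \<open>lu_inv St\<close>,
    whose rows may be infinite. Multiplication by the transpose of \<open>St\<close> is therefore
    done by finite sums over \<open>j \<le> n\<close> and not by associativity.\<close>
  have "S \<odot> g = S \<odot> (lu_inv S \<odot> sdiag h) \<odot> stransp (lu_inv St)"
    unfolding g_eq by (simp add: smat_mult_assoc[symmetric] rf S)
  also have "S \<odot> (lu_inv S \<odot> sdiag h) = sdiag h"
    by (simp add: smat_mult_assoc[symmetric] rf S mult_lu_inv)
  finally have Sg: "(S \<odot> g) i j = h i * lu_inv St j i" for j
    by (simp add: sdiag_mult stransp_def)
  have expand: "weighted_integral \<Delta> f (typeII_poly S i * typeI_poly St h Y n) =
      inverse (h n) * (\<Sum>j\<le>n. St n j * (\<Sum>k\<le>i. S i k * weighted_integral \<Delta> f (monom 1 k * Y j)))"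
    if "finite_moments \<Delta> f" for f Y
  proof -
    have "typeII_poly S i * typeI_poly St h Y n = smult (inverse (h n)) (\<Sum>j\<le>n. smult (St n j)
        (\<Sum>k\<le>i. smult (S i k) (monom 1 k * Y j)))"
      by (simp add: typeI_poly_def sum_distrib_left) (simp add: typeII_poly_def sum_distrib_right)
    with that show ?thesis by (simp add: weighted_integral_smult weighted_integral_sum)
  qed
  have "weighted_integral \<Delta> f1 (typeII_poly S i * typeI_poly St h monX1_poly n) +
      weighted_integral \<Delta> f2 (typeII_poly S i * typeI_poly St h monX2_poly n) =
      inverse (h n) * (\<Sum>j\<le>n. St n j * (\<Sum>k\<le>i. S i k * g k j))"
    by (simp add: expand assms g_entry distrib_left sum.distrib)
  also have "\<dots> = inverse (h n) * (\<Sum>j\<le>n. St n j * (h i * lu_inv St j i))"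
    by (simp add: lower_unitriangular_mult_expand[OF S, symmetric] Sg)
  also have "\<dots> = inverse (h n) * (h i * (St \<odot> lu_inv St) n i)"
    by (simp add: lower_unitriangular_mult_expand[OF St] sum_distrib_left mult.left_commute)
  also have "\<dots> = (if i = n then 1 else 0)"
    using h by (simp add: mult_lu_inv St sone_def sdiag_def)
  finally show ?thesis .
qed

text \<open>The Pearson equation makes the integrand the derivative of the product of
  \<open>p\<close>, \<open>\<sigma>\<close> and \<open>f\<close>, so the integral is a difference of
  boundary limits, and both are 0.\<close>

lemma pearson_weighted_integral_zero:
  assumes ivl: "is_interval \<Delta>"
    and moments: "finite_moments \<Delta> f"
    and pearson: "pearson \<Delta> \<sigma> q f"
    and boundary: "vanishes_at_boundary \<Delta> \<sigma> f"
  shows "weighted_integral \<Delta> f (pderiv (\<sigma> * p) + q * p) = 0"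
proof -
  \<comment> \<open>Extended real endpoints treat bounded and unbounded intervals together. For
    empty \<Delta> they are \<infinity> and -\<infinity>, which falls under the failure of
    \<open>a < b\<close>.\<close>
  define a where "a = (INF x\<in>\<Delta>. ereal x)"
  define b where "b = (SUP x\<in>\<Delta>. ereal x)"
  define F where "F x = poly p x * (poly \<sigma> x * f x)" for x
  define g where "g x = poly (pderiv (\<sigma> * p) + q * p) x * f x" for x
  have below_b: "\<exists>y\<in>\<Delta>. x < ereal y" if "x < b" for x
    using that by (simp add: b_def less_SUP_iff)
  have above_a: "\<exists>y\<in>\<Delta>. ereal y < x" if "a < x" for x
    using that by (simp add: a_def INF_less_iff)
  have ab: "a \<le> ereal x" "ereal x \<le> b" if "x \<in> \<Delta>" for x
    using that by (auto simp: a_def b_def intro: INF_lower SUP_upper)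
  have sub: "einterval a b \<subseteq> \<Delta>"
  proof
    fix x assume "x \<in> einterval a b"
    then obtain y z where "y \<in> \<Delta>" "y < x" "z \<in> \<Delta>" "x < z"
      using above_a[of "ereal x"] below_b[of "ereal x"] by (auto simp: einterval_iff)
    then show "x \<in> \<Delta>" using ivl unfolding is_interval_1 by (meson less_imp_le)
  qed
  have g_int: "set_integrable lborel \<Delta> g"
    unfolding g_def by (rule set_integrable_poly_mult[OF moments])
  then have g_int': "set_integrable lborel (einterval a b) g"
    by (rule set_integrable_subset) (simp_all add: sub)
  have int_eq: "(LBINT x:\<Delta>. g x) = (LBINT x:einterval a b. g x)"
  proof (rule set_integral_cong_set)
    \<comment> \<open>At an infinite endpoint \<open>real_of_ereal\<close> returns 0; the excluded
      set is still finite, hence null.\<close>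
    have "AE x in lborel. x \<notin> {real_of_ereal a, real_of_ereal b}"
      by (intro AE_not_in countable_imp_null_set_lborel) simp
    then show "AE x in lborel. (x \<in> einterval a b) = (x \<in> \<Delta>)"
    proof eventually_elim
      case (elim x)
      then have "ereal x \<noteq> a" "ereal x \<noteq> b" by auto
      then show ?case using sub ab[of x] by (auto simp: einterval_iff)
    qed
  qed (use g_int g_int' in \<open>auto simp: set_integrable_def set_borel_measurable_def\<close>)
  have "(LBINT x:einterval a b. g x) = 0"
  proof (cases "a < b")
    case True
    \<comment> \<open>In the open interval the derivative within \<Delta> is a two-sided
      derivative.\<close>
    have at: "at x within \<Delta> = at x" if "a < ereal x" "ereal x < b" for x
      using that sub by (intro at_within_open_subset[of x "einterval a b"]) (auto simp: einterval_iff)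
    have f_deriv: "\<exists>D. (f has_real_derivative D) (at x) \<and> poly \<sigma> x * D = poly q x * f x"
      if x: "a < ereal x" "ereal x < b" for x
      using pearson sub x unfolding pearson_def at[OF x, symmetric] by (auto simp: einterval_iff)
    have F_deriv: "(F has_vector_derivative g x) (at x)" if x: "a < ereal x" "ereal x < b" for x
    proof -
      obtain D where D: "(f has_real_derivative D) (at x)" "poly \<sigma> x * D = poly q x * f x"
        using f_deriv[OF x] by blast
      have "((\<lambda>x. poly (\<sigma> * p) x * f x) has_real_derivative
          poly (pderiv (\<sigma> * p)) x * f x + D * poly (\<sigma> * p) x) (at x)"
        by (intro DERIV_mult poly_DERIV D)
      also have "D * poly (\<sigma> * p) x = poly (q * p) x * f x"
        using D(2) by (simp add: mult.commute mult.left_commute)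
      finally show ?thesis
        unfolding F_def g_def has_real_derivative_iff_has_vector_derivative[symmetric]
        by (simp add: algebra_simps)
    qed
    have g_cont: "isCont g x" if x: "a < ereal x" "ereal x < b" for x
    proof -
      have "isCont f x" using f_deriv[OF x] DERIV_isCont by blast
      then show ?thesis unfolding g_def by (intro continuous_intros)
    qed
    have endpoint: "(F \<longlongrightarrow> 0) (at c within \<Delta>)" if "c \<in> frontier \<Delta>" for c
    proof -
      have "((\<lambda>x. poly \<sigma> x * f x) \<longlongrightarrow> 0) (at c within \<Delta>)"
        using boundary that by (simp add: vanishes_at_boundary_def)
      from tendsto_mult[OF tendsto_poly[OF tendsto_ident_at] this]
      show ?thesis unfolding F_def by simp
    qed
    \<comment> \<open>At infinity \<open>p\<close> may be unbounded, so \<open>F\<close> is split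
      along the monomials of \<open>p\<close> and the decay against every power is used.\<close>
    have infinite: "(F \<longlongrightarrow> 0) G"
      if "\<forall>k. ((\<lambda>x. x ^ k * (poly \<sigma> x * f x)) \<longlongrightarrow> 0) G" for G
    proof -
      have "((\<lambda>x. \<Sum>k\<le>degree p. coeff p k * (x ^ k * (poly \<sigma> x * f x))) \<longlongrightarrow> 0) G"
        using that by (intro tendsto_null_sum tendsto_mult_right_zero) auto
      then show ?thesis
        unfolding F_def poly_altdef[of p] by (simp add: sum_distrib_right mult.assoc)
    qed
    \<comment> \<open>An inner point that cuts off one-sided neighbourhoods of the endpoints
      contained in \<Delta>.\<close>
    obtain c where c: "a < ereal c" "ereal c < b"
      using einterval_nonempty[OF True] by (auto simp: einterval_iff)
    have lim_b: "((F \<circ> real_of_ereal) \<longlongrightarrow> 0) (at_left b)"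
    proof (cases b)
      case (real r)
      have l: "c < r" "{c<..<r} \<subseteq> \<Delta>"
      proof -
        show "c < r" using c real by simp
        have "{c<..<r} \<subseteq> einterval a b"
          using c less_trans[of a "ereal c"] by (auto simp: einterval_iff real)
        then show "{c<..<r} \<subseteq> \<Delta>" using sub by simp
      qed
      \<comment> \<open>A finite supremum is a frontier point: \<Delta> comes arbitrarily close to
        it, while an interior \<open>r\<close> would put some \<open>r + e\<close> into
        \<Delta>.\<close>
      have "r \<in> closure \<Delta>"
        unfolding closure_approachable
      proof (intro allI impI)
        fix e :: real assume "e > 0"
        then obtain y where "y \<in> \<Delta>" "r - e < y" using below_b[of "ereal (r - e)"] real by auto
        with ab(2)[of y] real show "\<exists>y\<in>\<Delta>. dist y r < e"
          by (intro bexI[of _ y]) (auto simp: dist_real_def)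
      qed
      moreover have "r \<notin> interior \<Delta>"
      proof
        assume "r \<in> interior \<Delta>"
        then obtain e where "e > 0" "cball r e \<subseteq> \<Delta>" by (auto simp: mem_interior_cball)
        then have "r + e \<in> \<Delta>" by (auto simp: dist_real_def subset_iff)
        with ab(2)[of "r + e"] real \<open>e > 0\<close> show False by simp
      qed
      ultimately have "(F \<longlongrightarrow> 0) (at r within \<Delta>)" by (intro endpoint) (simp add: frontier_def)
      then have "(F \<longlongrightarrow> 0) (at r within {c<..<r})" using l(2) by (rule tendsto_within_subset)
      moreover have "at r within {c<..<r} = at_left r"
        using l(1) by (intro at_within_nhd[of r "{c<..}"]) auto
      ultimately show ?thesis by (simp add: real ereal_tendsto_simps)
    next
      case PInf
      have "\<not> bdd_above \<Delta>"
      proof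
        assume "bdd_above \<Delta>"
        then obtain M where "\<forall>x\<in>\<Delta>. x \<le> M" by (auto simp: bdd_above_def)
        then show False using below_b[of "ereal M"] PInf by force
      qed
      then show ?thesis
        using boundary infinite[of at_top]
        by (simp add: PInf ereal_tendsto_simps vanishes_at_boundary_def)
    qed (use True in simp)
    have lim_a: "((F \<circ> real_of_ereal) \<longlongrightarrow> 0) (at_right a)"
    proof (cases a)
      case (real r)
      have l: "r < c" "{r<..<c} \<subseteq> \<Delta>"
      proof -
        show "r < c" using c real by simp
        have "{r<..<c} \<subseteq> einterval a b"
          using c less_trans[of _ "ereal c" b] by (auto simp: einterval_iff real)
        then show "{r<..<c} \<subseteq> \<Delta>" using sub by simp
      qed
      have "r \<in> closure \<Delta>"
        unfolding closure_approachable
      proof (intro allI impI)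
        fix e :: real assume "e > 0"
        then obtain y where "y \<in> \<Delta>" "y < r + e" using above_a[of "ereal (r + e)"] real by auto
        with ab(1)[of y] real show "\<exists>y\<in>\<Delta>. dist y r < e"
          by (intro bexI[of _ y]) (auto simp: dist_real_def)
      qed
      moreover have "r \<notin> interior \<Delta>"
      proof
        assume "r \<in> interior \<Delta>"
        then obtain e where "e > 0" "cball r e \<subseteq> \<Delta>" by (auto simp: mem_interior_cball)
        then have "r - e \<in> \<Delta>" by (auto simp: dist_real_def subset_iff)
        with ab(1)[of "r - e"] real \<open>e > 0\<close> show False by simp
      qed
      ultimately have "(F \<longlongrightarrow> 0) (at r within \<Delta>)" by (intro endpoint) (simp add: frontier_def)
      then have "(F \<longlongrightarrow> 0) (at r within {r<..<c})" using l(2) by (rule tendsto_within_subset)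
      moreover have "at r within {r<..<c} = at_right r"
        using l(1) by (intro at_within_nhd[of r "{..<c}"]) auto
      ultimately show ?thesis by (simp add: real ereal_tendsto_simps)
    next
      case MInf
      have "\<not> bdd_below \<Delta>"
      proof
        assume "bdd_below \<Delta>"
        then obtain M where "\<forall>x\<in>\<Delta>. M \<le> x" by (auto simp: bdd_below_def)
        then show False using above_a[of "ereal M"] MInf by force
      qed
      then show ?thesis
        using boundary infinite[of at_bot]
        by (simp add: MInf ereal_tendsto_simps vanishes_at_boundary_def)
    qed (use True in simp)
    have "(LBINT x=a..b. g x) = 0 - 0"
      using True F_deriv g_cont g_int' lim_a lim_b by (rule interval_integral_FTC_integrable)
    then show ?thesis using True by (simp add: interval_lebesgue_integral_def less_imp_le)
  next
    case False
    then have "einterval a b = {}" by (auto simp: einterval_iff dest: less_trans)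
    then show ?thesis by (simp add: set_lebesgue_integral_def)
  qed
  with int_eq show ?thesis by (simp add: weighted_integral_def g_def)
qed

section \<open>Differential equations for both families and the linear form\<close>

theorem theorem5:
  fixes \<Delta> :: "real set"
    and v w1 w2 wt1 wt2 :: "real \<Rightarrow> real"
    and \<sigma> q1 q2 :: "real poly"
    and S St \<Psi> :: smat and h :: svec
    and A1 A2 B Qt :: "real \<Rightarrow> svec"
  assumes interval: "is_interval \<Delta>"
    and wt1: "wt1 = (\<lambda>x. w1 x * v x)"
    and wt2: "wt2 = (\<lambda>x. w2 x * v x)"
    and moments1: "finite_moments \<Delta> wt1"
    and moments2: "finite_moments \<Delta> wt2"
    and GB: "gauss_borel (moment_matrix \<Delta> wt1 wt2) S h St"
    and B: "B = typeII S"
    and A1: "A1 = typeI St h monX1"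
    and A2: "A2 = typeI St h monX2"
    and Qt: "Qt = (\<lambda>x n. A1 x n * wt1 x + A2 x n * wt2 x)"
    and pearson1: "pearson \<Delta> \<sigma> q1 wt1"
    and pearson2: "pearson \<Delta> \<sigma> q2 wt2"
    and boundary1: "vanishes_at_boundary \<Delta> \<sigma> wt1"
    and boundary2: "vanishes_at_boundary \<Delta> \<sigma> wt2"
    and Psi: "\<Psi> = laguerre_freud \<sigma> S"
  shows
    (* the products with the transpose of \<Psi> below are finite sums *)
    "(\<forall>n. finite {k. \<Psi> k n \<noteq> 0}) \<and>
     (\<forall>x n. poly \<sigma> x * deriv (\<lambda>t. A1 t n) x + poly q1 x * A1 x n + (stransp \<Psi> \<odot>\<^sub>v A1 x) n = 0) \<and>
     (\<forall>x n. poly \<sigma> x * deriv (\<lambda>t. A2 t n) x + poly q2 x * A2 x n + (stransp \<Psi> \<odot>\<^sub>v A2 x) n = 0) \<and>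
     (\<forall>x\<in>\<Delta>. \<forall>n. \<exists>D. ((\<lambda>t. Qt t n) has_real_derivative D) (at x within \<Delta>) \<and>
       poly \<sigma> x * D + (stransp \<Psi> \<odot>\<^sub>v Qt x) n = 0) \<and>
     (\<forall>x n. deriv (\<lambda>t. poly \<sigma> t * B t n) x = (\<Psi> \<odot>\<^sub>v B x) n)"
proof -
  define b where "b = typeII_poly S"
  define a1 where "a1 = typeI_poly St h monX1_poly"
  define a2 where "a2 = typeI_poly St h monX2_poly"
  have S: "lower_unitriangular S" and St: "lower_unitriangular St" and h: "h n \<noteq> 0" for n
    using GB by (auto simp: gauss_borel_def)
  have A1_poly: "A1 x n = poly (a1 n) x" and A2_poly: "A2 x n = poly (a2 n) x" for x n
    by (simp_all add: A1 A2 a1_def a2_def poly_typeI_poly St poly_monX1_poly poly_monX2_poly)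
  note biorthogonal = gauss_borel_biorthogonal[OF GB moments1 moments2,
      folded a1_def a2_def b_def]
  \<comment> \<open>One \<open>N\<close> serves both families. The vanishing of column
    \<open>n\<close> of \<open>\<Psi>\<close> from \<open>N\<close> on makes the products with the
    transpose finite sums.\<close>
  have key: "\<exists>N. (\<forall>k\<ge>N. \<Psi> k n = 0) \<and>
      \<sigma> * pderiv (a1 n) + q1 * a1 n = - (\<Sum>k<N. smult (\<Psi> k n) (a1 k)) \<and>
      \<sigma> * pderiv (a2 n) + q2 * a2 n = - (\<Sum>k<N. smult (\<Psi> k n) (a2 k))" for n
  proof -
    obtain N e where
      e1: "\<sigma> * pderiv (a1 n) + q1 * a1 n = (\<Sum>k<N. smult (e k) (a1 k))" and
      e2: "\<sigma> * pderiv (a2 n) + q2 * a2 n = (\<Sum>k<N. smult (e k) (a2 k))"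
      unfolding a1_def a2_def by (rule typeI_poly_expansion[OF St h])
    \<comment> \<open>Padding \<open>e\<close> by 0 lets one identity give both
      \<open>e i = - \<Psi> i n\<close> below \<open>N\<close> and \<open>\<Psi> i n = 0\<close>
      from \<open>N\<close> on.\<close>
    have e: "\<Psi> i n + (if i < N then e i else 0) = 0" for i
    proof -
      define F where "F = {m. \<Psi> i m \<noteq> 0}"
      have F: "finite F"
        using row_finite_laguerre_freud[OF S] by (simp add: F_def Psi row_finite_def)
      \<comment> \<open>The vanishing integral is applied to \<open>b i * a\<close>. The product
        rule separates the derivative of \<open>\<sigma> * b i\<close>, which row \<open>i\<close>
        of \<open>\<Psi>\<close> expands.\<close>
      have by_parts: "(\<Sum>m\<in>F. \<Psi> i m * weighted_integral \<Delta> f (b m * a)) +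
          weighted_integral \<Delta> f (b i * (\<sigma> * pderiv a + q * a)) = 0"
        if "finite_moments \<Delta> f" "pearson \<Delta> \<sigma> q f" "vanishes_at_boundary \<Delta> \<sigma> f" for f q a
      proof -
        have "pderiv (\<sigma> * (b i * a)) + q * (b i * a) =
            pderiv (\<sigma> * b i) * a + b i * (\<sigma> * pderiv a + q * a)"
          unfolding mult.assoc[symmetric] pderiv_mult[of "\<sigma> * b i"] by (simp add: algebra_simps)
        also have "pderiv (\<sigma> * b i) * a = (\<Sum>m\<in>F. smult (\<Psi> i m) (b m * a))"
          by (simp add: b_def F_def Psi pderiv_mult_typeII_poly[OF S] sum_distrib_right)
        finally show ?thesis
          using pearson_weighted_integral_zero[OF interval that, of "b i * a"]
          by (simp add: weighted_integral_add weighted_integral_sum weighted_integral_smult that)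
      qed
      let ?I1 = "weighted_integral \<Delta> wt1" and ?I2 = "weighted_integral \<Delta> wt2"
      \<comment> \<open>Only the sum over both weights is biorthogonal. It collapses the first sum
        to \<open>\<Psi> i n\<close> and the second to the padded \<open>e i\<close>.\<close>
      have "0 = (\<Sum>m\<in>F. \<Psi> i m * (?I1 (b m * a1 n) + ?I2 (b m * a2 n))) +
          (?I1 (b i * (\<sigma> * pderiv (a1 n) + q1 * a1 n)) + ?I2 (b i * (\<sigma> * pderiv (a2 n) + q2 * a2 n)))"
        using by_parts[OF moments1 pearson1 boundary1, of "a1 n"]
          by_parts[OF moments2 pearson2 boundary2, of "a2 n"]
        by (simp add: distrib_left sum.distrib)
      also have "?I1 (b i * (\<sigma> * pderiv (a1 n) + q1 * a1 n)) +
          ?I2 (b i * (\<sigma> * pderiv (a2 n) + q2 * a2 n)) =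
          (\<Sum>k<N. e k * (?I1 (b i * a1 k) + ?I2 (b i * a2 k)))"
        by (simp add: e1 e2 sum_distrib_left weighted_integral_sum weighted_integral_smult
            moments1 moments2 distrib_left sum.distrib)
      finally show ?thesis
        using F
        by (auto simp: biorthogonal F_def if_distrib[where f = "\<lambda>x. _ * x"] cong: if_cong split: if_splits)
    qed
    have "e k = - \<Psi> k n" if "k < N" for k using e[of k] that by simp
    moreover have "\<Psi> k n = 0" if "k \<ge> N" for k using e[of k] that by simp
    ultimately show ?thesis
      by (intro exI[of _ N]) (simp add: e1 e2 sum_negf)
  qed
  have transp_vec: "(stransp \<Psi> \<odot>\<^sub>v u) n = (\<Sum>k<N. \<Psi> k n * u k)" if "\<forall>k\<ge>N. \<Psi> k n = 0" for N n u
    using that leI by (subst smat_vec_expand[of "{..<N}"]) (auto simp: stransp_def)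
  have finite: "finite {k. \<Psi> k n \<noteq> 0}" for n
  proof -
    obtain N where "\<forall>k\<ge>N. \<Psi> k n = 0" using key by blast
    then have "{k. \<Psi> k n \<noteq> 0} \<subseteq> {..<N}" using leI by blast
    then show ?thesis by (rule finite_subset) simp
  qed
  \<comment> \<open>Evaluating polynomial identities gives the equations at every real
    \<open>x\<close>, not only on \<Delta>.\<close>
  have ode: "poly \<sigma> x * poly (pderiv (a1 n)) x + poly q1 x * A1 x n + (stransp \<Psi> \<odot>\<^sub>v A1 x) n = 0"
    "poly \<sigma> x * poly (pderiv (a2 n)) x + poly q2 x * A2 x n + (stransp \<Psi> \<odot>\<^sub>v A2 x) n = 0" for x n
  proof -
    obtain N where N: "\<forall>k\<ge>N. \<Psi> k n = 0"
      and u: "\<sigma> * pderiv (a1 n) + q1 * a1 n = - (\<Sum>k<N. smult (\<Psi> k n) (a1 k))"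
        "\<sigma> * pderiv (a2 n) + q2 * a2 n = - (\<Sum>k<N. smult (\<Psi> k n) (a2 k))"
      using key by blast
    from arg_cong[OF u(1), of "\<lambda>p. poly p x"] arg_cong[OF u(2), of "\<lambda>p. poly p x"]
    show "poly \<sigma> x * poly (pderiv (a1 n)) x + poly q1 x * A1 x n + (stransp \<Psi> \<odot>\<^sub>v A1 x) n = 0"
      "poly \<sigma> x * poly (pderiv (a2 n)) x + poly q2 x * A2 x n + (stransp \<Psi> \<odot>\<^sub>v A2 x) n = 0"
      by (simp_all add: transp_vec[OF N] A1_poly A2_poly poly_sum)
  qed
  have A_deriv: "((\<lambda>t. A1 t n) has_real_derivative poly (pderiv (a1 n)) x) (at x)"
    "((\<lambda>t. A2 t n) has_real_derivative poly (pderiv (a2 n)) x) (at x)" for x n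
    by (simp_all add: A1_poly A2_poly poly_DERIV)
  have Q: "\<exists>D. ((\<lambda>t. Qt t n) has_real_derivative D) (at x within \<Delta>) \<and>
      poly \<sigma> x * D + (stransp \<Psi> \<odot>\<^sub>v Qt x) n = 0" if x: "x \<in> \<Delta>" for x n
  proof -
    obtain D1 D2 where
      D1: "(wt1 has_real_derivative D1) (at x within \<Delta>)" "poly \<sigma> x * D1 = poly q1 x * wt1 x" and
      D2: "(wt2 has_real_derivative D2) (at x within \<Delta>)" "poly \<sigma> x * D2 = poly q2 x * wt2 x"
      using pearson1 pearson2 x unfolding pearson_def by metis
    define D where "D = (poly (pderiv (a1 n)) x * wt1 x + D1 * A1 x n) +
      (poly (pderiv (a2 n)) x * wt2 x + D2 * A2 x n)"
    have "((\<lambda>t. Qt t n) has_real_derivative D) (at x within \<Delta>)"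
      unfolding Qt D_def
      by (intro DERIV_add DERIV_mult D1 D2 A_deriv[THEN has_field_derivative_at_within])
    moreover have "poly \<sigma> x * D + (stransp \<Psi> \<odot>\<^sub>v Qt x) n = 0"
    proof -
      obtain N where N: "\<forall>k\<ge>N. \<Psi> k n = 0" using key by blast
      have Qt_vec: "(stransp \<Psi> \<odot>\<^sub>v Qt x) n =
          (stransp \<Psi> \<odot>\<^sub>v A1 x) n * wt1 x + (stransp \<Psi> \<odot>\<^sub>v A2 x) n * wt2 x"
        unfolding transp_vec[OF N] by (simp add: Qt sum_distrib_right distrib_left sum.distrib mult.assoc)
      \<comment> \<open>Moving \<open>\<sigma>\<close> onto \<open>D1\<close> and \<open>D2\<close>
        lets the Pearson equations produce exactly the \<open>q1\<close> and \<open>q2\<close> terms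
        of the type I equations.\<close>
      have "poly \<sigma> x * D =
          (poly \<sigma> x * poly (pderiv (a1 n)) x) * wt1 x + (poly \<sigma> x * D1) * A1 x n +
          ((poly \<sigma> x * poly (pderiv (a2 n)) x) * wt2 x + (poly \<sigma> x * D2) * A2 x n)"
        by (simp add: D_def algebra_simps)
      also have "\<dots> = (poly \<sigma> x * poly (pderiv (a1 n)) x + poly q1 x * A1 x n) * wt1 x +
          (poly \<sigma> x * poly (pderiv (a2 n)) x + poly q2 x * A2 x n) * wt2 x"
        unfolding D1(2) D2(2) by (simp add: algebra_simps)
      also have "\<dots> = - (stransp \<Psi> \<odot>\<^sub>v A1 x) n * wt1 x + - (stransp \<Psi> \<odot>\<^sub>v A2 x) n * wt2 x"
        using ode[of x n] by (simp add: add_eq_0_iff2 )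
      finally show ?thesis by (simp add: Qt_vec)
    qed
    ultimately show ?thesis by blast
  qed
  show ?thesis
    using finite ode Q A_deriv[THEN DERIV_imp_deriv]
      laguerre_freud_typeII[OF S, THEN DERIV_imp_deriv]
    by (simp add: B Psi)
qed

end
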